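(* For $m\ge1$ and $n\ge0$, $$\sum_{k\ge0}(-q)^{n-k}\,\tilde S^o[m,n,k]=1,$$ where $\tilde S^o[m,n,k]=[km]!_m\,h_{n-k}([m-1],[2m-1],\dots,[(k+1)m-1])$.
   Context: $[j]=1+q+\dots+q^{j-1}$ (so $[0]=0$); $[km]!_m=[m][2m]\cdots[km]$ (empty product $1$ for $k=0$); $h_j$ is the complete homogeneous symmetric polynomial of degree $j$, with $h_j=0$ for $j<0$. *)

theory Defs
  imports "HOL-Library.Multiset" "HOL-Library.Groups_Big_Fun"
begin

definition qnum :: "'a::comm_ring_1 \<Rightarrow> nat \<Rightarrow> 'a" where
  "qnum q j = (\<Sum>i<j. q ^ i)"

text \<open>\<open>qfact q m k\<close> is \<open>[km]!_m = [m][2m]\<cdots>[km]\<close>.\<close>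

definition qfact :: "'a::comm_ring_1 \<Rightarrow> nat \<Rightarrow> nat \<Rightarrow> 'a" where
  "qfact q m k = (\<Prod>i=1..k. qnum q (i * m))"

text \<open>The value of the complete homogeneous symmetric polynomial of degree \<open>j\<close> at the entries of
  \<open>xs\<close>. A monomial of degree \<open>j\<close> is a multiset of \<open>j\<close> positions; positions are used rather than
  values since entries of \<open>xs\<close> may coincide. The degree is an integer, and for \<open>j < 0\<close> the
  sum is empty, so its value is \<open>0\<close>.\<close>

definition complete_homogeneous :: "int \<Rightarrow> 'a::comm_ring_1 list \<Rightarrow> 'a" where
  "complete_homogeneous j xs =
     (\<Sum>M | set_mset M \<subseteq> {..<length xs} \<and> int (size M) = j. \<Prod>i\<in>#M. xs ! i)"

definition S_tilde_o :: "'a::comm_ring_1 \<Rightarrow> nat \<Rightarrow> nat \<Rightarrow> nat \<Rightarrow> 'a" where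
  "S_tilde_o q m n k =
     qfact q m k *
     complete_homogeneous (int n - int k) (map (\<lambda>i. qnum q (i * m - 1)) [1..<k + 2])"

end

theory Submission
  imports Defs
begin

text \<open>With \<open>c = -q\<close> and \<open>a i = [im - 1]\<close> one has \<open>[im] = 1 - c a i\<close>, so the sum is an instance of
  \<open>\<Sum>k\<le>n. c^(n-k) (1 - c a 1)\<cdots>(1 - c a k) h_(n-k)(a 1, \<dots>, a (k+1)) = 1\<close>.
  Splitting each \<open>h\<close> according to whether the last variable \<open>a (k+1)\<close> occurs makes the sum for
  \<open>n + 1\<close> collapse to the sum for \<open>n\<close>.\<close>

lemma complete_homogeneous_of_nat:
  "complete_homogeneous (int d) xs = (\<Sum>M\<in>multisets_of_size {..<length xs} d. \<Prod>i\<in>#M. xs ! i)"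
  by (simp add: complete_homogeneous_def multisets_of_size_def)

lemma complete_homogeneous_neg: "j < 0 \<Longrightarrow> complete_homogeneous j xs = 0"
  by (auto simp: complete_homogeneous_def intro!: sum.neutral)

lemma complete_homogeneous_0: "complete_homogeneous 0 xs = 1"
  using complete_homogeneous_of_nat[of 0 xs] by simp

lemma complete_homogeneous_Nil: "d > 0 \<Longrightarrow> complete_homogeneous (int d) [] = 0"
  by (simp add: complete_homogeneous_of_nat)

text \<open>Remove one copy of \<open>a\<close> if there is one. The rest may contain
  \<open>a\<close> again, hence \<open>insert a A\<close> in the second part.\<close>

lemma multisets_of_size_insert_Suc:
  "multisets_of_size (insert a A) (Suc d) =
     multisets_of_size A (Suc d) \<union> add_mset a ` multisets_of_size (insert a A) d"
proof (intro equalityI subsetI)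
  fix M assume M: "M \<in> multisets_of_size (insert a A) (Suc d)"
  show "M \<in> multisets_of_size A (Suc d) \<union> add_mset a ` multisets_of_size (insert a A) d"
  proof (cases "a \<in># M")
    case True
    then obtain N where "M = add_mset a N" by (metis mset_add)
    with M show ?thesis by (auto simp: multisets_of_size_def)
  next
    case False
    with M show ?thesis by (auto simp: multisets_of_size_def)
  qed
qed (auto simp: multisets_of_size_def)

text \<open>Monomials avoiding the last position form the first summand; from any other one, a
  single factor \<open>x\<close> splits off.\<close>

lemma complete_homogeneous_snoc:
  "complete_homogeneous (int (Suc d)) (xs @ [x]) =
     complete_homogeneous (int (Suc d)) xs + x * complete_homogeneous (int d) (xs @ [x])"
proof -
  define l where "l = length xs"
  define f where "f M = (\<Prod>i\<in>#M. (xs @ [x]) ! i)" for M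
  let ?old = "multisets_of_size {..<l} (Suc d)"
  let ?rest = "multisets_of_size {..<Suc l} d"
  have "complete_homogeneous (int (Suc d)) (xs @ [x]) = sum f (?old \<union> add_mset l ` ?rest)"
    by (simp add: complete_homogeneous_of_nat lessThan_Suc multisets_of_size_insert_Suc l_def f_def
        del: of_nat_Suc)
  also have "\<dots> = sum f ?old + sum f (add_mset l ` ?rest)"
    by (rule sum.union_disjoint) (auto dest: multisets_of_size_subset)
  also have "sum f ?old = complete_homogeneous (int (Suc d)) xs"
    unfolding complete_homogeneous_of_nat f_def l_def
    by (intro sum.cong refl arg_cong[where f = prod_mset] image_mset_cong)
      (auto simp: nth_append multisets_of_size_def)
  also have "sum f (add_mset l ` ?rest) = x * complete_homogeneous (int d) (xs @ [x])"
    by (subst sum.reindex)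
      (auto simp: inj_on_def f_def l_def complete_homogeneous_of_nat sum_distrib_left)
  finally show ?thesis .
qed

lemma sum_prod_complete_homogeneous:
  fixes a :: "nat \<Rightarrow> 'a::comm_ring_1"
  shows "(\<Sum>k\<le>n. c ^ (n - k) * ((\<Prod>i=1..k. 1 - c * a i) *
           complete_homogeneous (int (n - k)) (map a [1..<k + 2]))) = 1"
proof -
  define P where "P k = (\<Prod>i=1..k. 1 - c * a i)" for k
  \<comment> \<open>\<open>k\<close> counts the variables, so \<open>h_Suc\<close> is a recurrence
    in \<open>k\<close> that starts from no variables.\<close>
  define h where "h d k = complete_homogeneous (int d) (map a [1..<Suc k])" for d k
  have P_Suc: "P (Suc k) = P k * (1 - c * a (Suc k))" for k
    by (simp add: P_def)
  have h_0: "h 0 k = 1" for k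
    by (simp add: h_def complete_homogeneous_0)
  have h_Suc_0: "h (Suc d) 0 = 0" for d
    using complete_homogeneous_Nil[of "Suc d"] by (simp add: h_def)
  have h_Suc: "h (Suc d) (Suc k) = h (Suc d) k + a (Suc k) * h d (Suc k)" for d k
    using complete_homogeneous_snoc[of d "map a [1..<Suc k]" "a (Suc k)"] by (simp add: h_def)
  have "(\<Sum>k\<le>n. c ^ (n - k) * (P k * h (n - k) (Suc k))) = 1"
  proof (induction n)
    case 0
    show ?case by (simp add: P_def h_0)
  next
    case (Suc n)
    have "(\<Sum>k\<le>Suc n. c ^ (Suc n - k) * (P k * h (Suc n - k) (Suc k)))
        = (\<Sum>k\<le>n. c ^ (Suc n - k) * (P k * h (Suc n - k) (Suc k))) + P (Suc n) * h 0 (Suc n)"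
      by (simp add: h_0)
    also have "(\<Sum>k\<le>n. c ^ (Suc n - k) * (P k * h (Suc n - k) (Suc k)))
        = (\<Sum>k\<le>n. c ^ (Suc n - k) * (P k * h (Suc n - k) k))
          + (\<Sum>k\<le>n. c ^ (n - k) * (P k * (c * a (Suc k)) * h (n - k) (Suc k)))"
      by (simp add: sum.distrib[symmetric] Suc_diff_le h_Suc algebra_simps)
    \<comment> \<open>The top term now fits as the summand \<open>k = Suc n\<close> of the first
      sum.\<close>
    also have "\<dots> + P (Suc n) * h 0 (Suc n)
        = (\<Sum>k\<le>Suc n. c ^ (Suc n - k) * (P k * h (Suc n - k) k))
          + (\<Sum>k\<le>n. c ^ (n - k) * (P k * (c * a (Suc k)) * h (n - k) (Suc k)))"
      by simp
    \<comment> \<open>Shift the index: the term \<open>k = 0\<close> has positive degree in no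
      variables and vanishes.\<close>
    also have "(\<Sum>k\<le>Suc n. c ^ (Suc n - k) * (P k * h (Suc n - k) k))
        = (\<Sum>k\<le>n. c ^ (n - k) * (P (Suc k) * h (n - k) (Suc k)))"
      by (subst sum.atMost_Suc_shift) (simp add: h_Suc_0)
    \<comment> \<open>The coefficients recombine:
      \<open>P (Suc k) + P k * (c * a (Suc k)) = P k\<close>.\<close>
    also have "\<dots> + (\<Sum>k\<le>n. c ^ (n - k) * (P k * (c * a (Suc k)) * h (n - k) (Suc k)))
        = (\<Sum>k\<le>n. c ^ (n - k) * (P k * h (n - k) (Suc k)))"
      by (simp add: sum.distrib[symmetric] P_Suc algebra_simps)
    finally show ?case using Suc.IH by simp
  qed
  then show ?thesis
    by (simp add: P_def h_def)
qed

lemma qnum_Suc: "qnum q (Suc j) = 1 + q * qnum q j"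
  by (simp only: qnum_def sum.lessThan_Suc_shift) (simp add: sum_distrib_left)

(* The sum ranges over all natural numbers k. The exponent n - k is truncated subtraction,
   but this only affects k > n, where S_tilde_o q m n k = 0. *)
theorem theorem4p8:
  fixes q :: "'a::comm_ring_1" and m n :: nat
  assumes "m \<ge> 1"
  shows "Sum_any (\<lambda>k::nat. (- q) ^ (n - k) * S_tilde_o q m n k) = 1"
proof -
  define a where "a i = qnum q (i * m - 1)" for i
  \<comment> \<open>Since \<open>i\<close> and \<open>m\<close> are positive,
    \<open>i * m - 1\<close> is not truncated and its successor is \<open>i * m\<close>.\<close>
  have qnum_mult: "qnum q (i * m) = 1 - (- q) * a i" if "i \<ge> 1" for i
    using qnum_Suc[of q "i * m - 1"] that assms by (simp add: a_def)
  have S: "S_tilde_o q m n k = (\<Prod>i=1..k. 1 - (- q) * a i) *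
      complete_homogeneous (int (n - k)) (map a [1..<k + 2])" if "k \<le> n" for k
  proof -
    have "qfact q m k = (\<Prod>i=1..k. 1 - (- q) * a i)"
      unfolding qfact_def by (intro prod.cong refl qnum_mult) simp
    then show ?thesis
      using that by (simp add: S_tilde_o_def a_def[abs_def] of_nat_diff)
  qed
  have zero: "S_tilde_o q m n k = 0" if "k \<notin> {..n}" for k
    using that by (simp add: S_tilde_o_def complete_homogeneous_neg)
  \<comment> \<open>A finite set containing the support turns \<open>Sum_any\<close> into an
    ordinary sum.\<close>
  have "{k. (- q) ^ (n - k) * S_tilde_o q m n k \<noteq> 0} \<subseteq> {..n}"
    by (rule subsetI, rule ccontr) (simp add: zero del: atMost_iff)
  then have "Sum_any (\<lambda>k. (- q) ^ (n - k) * S_tilde_o q m n k) =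
      (\<Sum>k\<le>n. (- q) ^ (n - k) * S_tilde_o q m n k)"
    by (intro Sum_any.expand_superset) simp_all
  also have "\<dots> = (\<Sum>k\<le>n. (- q) ^ (n - k) * ((\<Prod>i=1..k. 1 - (- q) * a i) *
      complete_homogeneous (int (n - k)) (map a [1..<k + 2])))"
    by (intro sum.cong refl) (simp only: S atMost_iff)
  also have "\<dots> = 1"
    by (rule sum_prod_complete_homogeneous)
  finally show ?thesis .
qed

end
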